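(* If $\mu$ is a ULC probability measure on $\mathbb N^d$, then for every $\mathbf p\in(0,1]^d$, the coordinatewise binomially thinned measure $\mathcal T_{\mathbf p}\mu$ is ULC.
   Context: $\mathbb N=\{0,1,2,\dots\}$, $[d]=\{1,\dots,d\}$, $\mathbf e_i$ is the $i$-th standard basis vector, $\mathbf n!=\prod_{i=1}^dn_i!$. Thinning: $\mathcal T_{\mathbf p}\mu=\mathrm{Law}(\mathbf X')$, where $\mathbf X\sim\mu$ and, conditional on $\mathbf X=\mathbf n$, the coordinates $X_i'$ are independent with $X_i'\sim\mathrm{Bin}(n_i,p_i)$. ULC: a set $S\subseteq\mathbb N^d$ is downward closed if $\mathbf n\in S$ and $\mathbf 0\le\mathbf m\le\mathbf n$ (coordinatewise) imply $\mathbf m\in S$. A probability measure $\mu$ on $\mathbb N^d$ with downward closed support is ULC (ultra-log-concave) if, with $a(\mathbf n)=\mathbf n!\,\mu(\mathbf n)$ and $\mathcal I_{\mathbf n}=\{i\in[d]:\mathbf n+\mathbf e_i\in\mathrm{supp}(\mu)\}$, the matrix $\big(1-\frac{a(\mathbf n)a(\mathbf n+\mathbf e_i+\mathbf e_j)}{a(\mathbf n+\mathbf e_i)a(\mathbf n+\mathbf e_j)}\big)_{i,j\in\mathcal I_{\mathbf n}}$ is positive semidefinite for every $\mathbf n\in\mathrm{supp}(\mu)$. *)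

theory Defs
  imports "HOL-Probability.Probability" "HOL-Library.Function_Algebras"
begin

text \<open>
  The index set \<open>[d]\<close> is a finite type \<open>'d\<close>, and \<open>\<nat>\<^sup>d\<close> is the type \<open>'d \<Rightarrow> nat\<close> with the pointwise
  addition and order. Since \<open>\<nat>\<^sup>d\<close> is countable, a probability measure on it is a \<open>pmf\<close>.
\<close>

definition unit_fun :: "'d \<Rightarrow> 'd \<Rightarrow> nat" where
  "unit_fun i = (\<lambda>k. if k = i then 1 else 0)"

definition downward_closed :: "('d \<Rightarrow> nat) set \<Rightarrow> bool" where
  "downward_closed S \<longleftrightarrow> (\<forall>n\<in>S. \<forall>m. m \<le> n \<longrightarrow> m \<in> S)"

text \<open>
  A matrix indexed by a finite set \<open>I\<close> is a function of which only the entries over \<open>I \<times> I\<close> matter.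
\<close>

definition psd_on :: "'i set \<Rightarrow> ('i \<Rightarrow> 'i \<Rightarrow> real) \<Rightarrow> bool" where
  "psd_on I M \<longleftrightarrow>
     (\<forall>i\<in>I. \<forall>j\<in>I. M i j = M j i) \<and>
     (\<forall>x :: 'i \<Rightarrow> real. 0 \<le> (\<Sum>i\<in>I. \<Sum>j\<in>I. x i * M i j * x j))"

definition fact_weight :: "('d::finite \<Rightarrow> nat) pmf \<Rightarrow> ('d \<Rightarrow> nat) \<Rightarrow> real" where
  "fact_weight \<mu> n = (\<Prod>i\<in>UNIV. fact (n i)) * pmf \<mu> n"

definition up_dirs :: "('d \<Rightarrow> nat) pmf \<Rightarrow> ('d \<Rightarrow> nat) \<Rightarrow> 'd set" where
  "up_dirs \<mu> n = {i. n + unit_fun i \<in> set_pmf \<mu>}"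

definition ULC :: "('d::finite \<Rightarrow> nat) pmf \<Rightarrow> bool" where
  "ULC \<mu> \<longleftrightarrow>
     downward_closed (set_pmf \<mu>) \<and>
     (\<forall>n\<in>set_pmf \<mu>. psd_on (up_dirs \<mu> n)
        (\<lambda>i j. 1 - fact_weight \<mu> n * fact_weight \<mu> (n + unit_fun i + unit_fun j) /
                   (fact_weight \<mu> (n + unit_fun i) * fact_weight \<mu> (n + unit_fun j))))"

text \<open>
  The default value \<open>0\<close> of \<open>Pi_pmf\<close> is immaterial, as the product is over all of \<open>UNIV\<close>.
\<close>

definition thinning :: "('d::finite \<Rightarrow> real) \<Rightarrow> ('d \<Rightarrow> nat) pmf \<Rightarrow> ('d \<Rightarrow> nat) pmf" where
  "thinning p \<mu> = bind_pmf \<mu> (\<lambda>n. Pi_pmf UNIV 0 (\<lambda>i. binomial_pmf (n i) (p i)))"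

end

theory Submission
  imports Defs
begin

text \<open>
  Write \<open>a (n) = n! \<mu> (n)\<close>. Up to the factor \<open>p\<^sub>k\<close> to the power \<open>n\<^sub>k\<close>, thinning coordinate \<open>k\<close> turns \<open>a\<close>
  into \<open>exp (q E) a\<close>, where \<open>q = 1 - p\<^sub>k\<close> and \<open>(E a) (n) = a (n + e\<^sub>k)\<close>. This operator is the limit
  of the powers \<open>(1 + (q / N) E)\<^sup>N\<close>, so it suffices that each \<open>1 + s E\<close> with \<open>s \<ge> 0\<close> preserves
  ultra-log-concavity, which is a statement about the sum of two quadratic forms with at most one
  positive eigenvalue that have a row in common.
\<close>

section \<open>Ultra-log-concavity as an inequality for weights\<close>

text \<open>This is ULC with the denominators cleared by
  \<open>x i = a (n + unit_fun i) * v i\<close>. The sums then run over all directions, and the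
  inequality is polynomial in the values of \<open>a\<close>: it makes sense off the support and for
  unnormalised weights, and it passes to pointwise limits.\<close>

definition ulc_weight :: "(('d::finite \<Rightarrow> nat) \<Rightarrow> real) \<Rightarrow> bool" where
  "ulc_weight a \<longleftrightarrow>
     (\<forall>n. 0 \<le> a n) \<and>
     (\<forall>m n. m \<le> n \<longrightarrow> a m = 0 \<longrightarrow> a n = 0) \<and>
     (\<forall>n v. a n * (\<Sum>i\<in>UNIV. \<Sum>j\<in>UNIV. v i * a (n + unit_fun i + unit_fun j) * v j)
              \<le> (\<Sum>i\<in>UNIV. a (n + unit_fun i) * v i)\<^sup>2)"

lemma ulc_weightI:
  assumes "\<And>n. 0 \<le> a n"
    and "\<And>m n. m \<le> n \<Longrightarrow> a m = 0 \<Longrightarrow> a n = 0"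
    and "\<And>n v. a n * (\<Sum>i\<in>UNIV. \<Sum>j\<in>UNIV. v i * a (n + unit_fun i + unit_fun j) * v j)
              \<le> (\<Sum>i\<in>UNIV. a (n + unit_fun i) * v i)\<^sup>2"
  shows "ulc_weight a"
  using assms unfolding ulc_weight_def by blast

lemma
  assumes "ulc_weight a"
  shows ulc_weight_nonneg: "0 \<le> a n"
    and ulc_weight_zero_mono: "m \<le> n \<Longrightarrow> a m = 0 \<Longrightarrow> a n = 0"
    and ulc_weight_form_le:
      "a n * (\<Sum>i\<in>UNIV. \<Sum>j\<in>UNIV. v i * a (n + unit_fun i + unit_fun j) * v j)
         \<le> (\<Sum>i\<in>UNIV. a (n + unit_fun i) * v i)\<^sup>2"
  using assms unfolding ulc_weight_def by blast+

lemma le_add_fun: "(n :: 'd \<Rightarrow> nat) \<le> n + m"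
  by (simp add: le_fun_def)

text \<open>A direction with \<open>a (n + unit_fun i) = 0\<close> contributes nothing, because
  downward closure makes its second shifts vanish as well; on the remaining directions the
  substitution is invertible. For \<open>n\<close> outside the support the left side is 0.\<close>

lemma ULC_iff_ulc_weight: "ULC \<mu> \<longleftrightarrow> ulc_weight (fact_weight \<mu>)"
proof -
  define a where "a = fact_weight \<mu>"
  have nonneg: "0 \<le> a n" for n
    by (simp add: a_def fact_weight_def prod_nonneg)
  have supp: "n \<in> set_pmf \<mu> \<longleftrightarrow> a n \<noteq> 0" for n
    by (simp add: a_def fact_weight_def set_pmf_iff)
  have dc: "downward_closed (set_pmf \<mu>) \<longleftrightarrow> (\<forall>m n. m \<le> n \<longrightarrow> a m = 0 \<longrightarrow> a n = 0)"
    unfolding downward_closed_def Ball_def supp by metis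
  have psd: "psd_on (up_dirs \<mu> n)
        (\<lambda>i j. 1 - a n * a (n + unit_fun i + unit_fun j) /
                   (a (n + unit_fun i) * a (n + unit_fun j))) \<longleftrightarrow>
      (\<forall>v. a n * (\<Sum>i\<in>UNIV. \<Sum>j\<in>UNIV. v i * a (n + unit_fun i + unit_fun j) * v j)
              \<le> (\<Sum>i\<in>UNIV. a (n + unit_fun i) * v i)\<^sup>2)" (is "?psd \<longleftrightarrow> (\<forall>v. ?form v)")
    if down: "\<forall>m n. m \<le> n \<longrightarrow> a m = 0 \<longrightarrow> a n = 0" for n
  proof -
    define I where "I = up_dirs \<mu> n"
    define b where "b i = a (n + unit_fun i)" for i
    define c where "c i j = a (n + unit_fun i + unit_fun j)" for i j
    have I: "i \<in> I \<longleftrightarrow> b i \<noteq> 0" for i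
      by (simp add: I_def up_dirs_def supp b_def)
    have c_sym: "c i j = c j i" for i j
      by (simp add: c_def add_ac)
    have c0: "c i j = 0" if "b i = 0" for i j
      using that unfolding b_def c_def by (rule down[rule_format, OF le_add_fun])
    have c0': "c i j = 0" if "b j = 0" for i j
      unfolding c_sym[of i j] using that by (rule c0)
    have restrict1: "(\<Sum>i\<in>UNIV. b i * v i) = (\<Sum>i\<in>I. b i * v i)" for v
      by (rule sum.mono_neutral_right) (auto simp: I)
    have restrict2: "(\<Sum>i\<in>UNIV. \<Sum>j\<in>UNIV. v i * c i j * v j) = (\<Sum>i\<in>I. \<Sum>j\<in>I. v i * c i j * v j)"
      for v
    proof -
      have "(\<Sum>i\<in>UNIV. \<Sum>j\<in>UNIV. v i * c i j * v j) = (\<Sum>i\<in>I. \<Sum>j\<in>UNIV. v i * c i j * v j)"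
        by (rule sum.mono_neutral_right) (auto simp: I c0)
      also have "\<dots> = (\<Sum>i\<in>I. \<Sum>j\<in>I. v i * c i j * v j)"
        by (intro sum.cong refl sum.mono_neutral_right) (auto simp: I c0')
      finally show ?thesis .
    qed
    \<comment> \<open>the substitution \<open>x\<^sub>i = b\<^sub>i v\<^sub>i\<close>\<close>
    have subst: "(\<Sum>i\<in>I. \<Sum>j\<in>I. (b i * v i) * (1 - a n * c i j / (b i * b j)) * (b j * v j))
        = (\<Sum>i\<in>I. b i * v i)\<^sup>2 - a n * (\<Sum>i\<in>I. \<Sum>j\<in>I. v i * c i j * v j)" for v
    proof -
      have "(\<Sum>i\<in>I. \<Sum>j\<in>I. (b i * v i) * (1 - a n * c i j / (b i * b j)) * (b j * v j))
          = (\<Sum>i\<in>I. \<Sum>j\<in>I. (b i * v i) * (b j * v j) - a n * (v i * c i j * v j))"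
        by (intro sum.cong refl) (auto simp: I field_simps)
      also have "\<dots> = (\<Sum>i\<in>I. b i * v i)\<^sup>2 - a n * (\<Sum>i\<in>I. \<Sum>j\<in>I. v i * c i j * v j)"
        unfolding power2_eq_square sum_product by (simp add: sum_subtractf sum_distrib_left)
      finally show ?thesis .
    qed
    have form: "?form v \<longleftrightarrow>
        0 \<le> (\<Sum>i\<in>I. \<Sum>j\<in>I. (b i * v i) * (1 - a n * c i j / (b i * b j)) * (b j * v j))" for v
      unfolding subst restrict1[symmetric] restrict2[symmetric] by (simp only: b_def c_def diff_ge_0_iff_ge)
    have sym: "1 - a n * c i j / (b i * b j) = 1 - a n * c j i / (b j * b i)" for i j
      unfolding c_sym[of i j] mult.commute[of "b i" "b j"] ..
    have "?psd \<longleftrightarrow>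
        (\<forall>x. 0 \<le> (\<Sum>i\<in>I. \<Sum>j\<in>I. x i * (1 - a n * c i j / (b i * b j)) * x j))"
      unfolding psd_on_def I_def[symmetric] b_def[symmetric] c_def[symmetric]
      using sym by blast
    also have "\<dots> \<longleftrightarrow> (\<forall>v. ?form v)"
    proof
      assume "\<forall>x. 0 \<le> (\<Sum>i\<in>I. \<Sum>j\<in>I. x i * (1 - a n * c i j / (b i * b j)) * x j)"
      then show "\<forall>v. ?form v"
        unfolding form by auto
    next
      assume R: "\<forall>v. ?form v"
      show "\<forall>x. 0 \<le> (\<Sum>i\<in>I. \<Sum>j\<in>I. x i * (1 - a n * c i j / (b i * b j)) * x j)"
      proof
        fix x
        have "(\<Sum>i\<in>I. \<Sum>j\<in>I. x i * (1 - a n * c i j / (b i * b j)) * x j) =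
          (\<Sum>i\<in>I. \<Sum>j\<in>I. (b i * (x i / b i)) * (1 - a n * c i j / (b i * b j)) * (b j * (x j / b j)))"
          by (intro sum.cong refl) (auto simp: I)
        then show "0 \<le> (\<Sum>i\<in>I. \<Sum>j\<in>I. x i * (1 - a n * c i j / (b i * b j)) * x j)"
          using R[rule_format, of "\<lambda>i. x i / b i", unfolded form] by simp
      qed
    qed
    finally show ?thesis .
  qed
  have "(\<forall>n\<in>set_pmf \<mu>. psd_on (up_dirs \<mu> n)
        (\<lambda>i j. 1 - a n * a (n + unit_fun i + unit_fun j) /
                   (a (n + unit_fun i) * a (n + unit_fun j)))) \<longleftrightarrow>
      (\<forall>n v. a n * (\<Sum>i\<in>UNIV. \<Sum>j\<in>UNIV. v i * a (n + unit_fun i + unit_fun j) * v j)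
              \<le> (\<Sum>i\<in>UNIV. a (n + unit_fun i) * v i)\<^sup>2)" (is "_ \<longleftrightarrow> (\<forall>n v. ?form n v)")
    if down: "\<forall>m n. m \<le> n \<longrightarrow> a m = 0 \<longrightarrow> a n = 0"
  proof -
    have triv: "?form n v" if "a n = 0" for n v
      using that by simp
    show ?thesis
      unfolding Ball_def supp psd[OF down]
    proof (intro iffI allI impI)
      fix n v
      assume "\<forall>n. a n \<noteq> 0 \<longrightarrow> (\<forall>v. ?form n v)"
      then show "?form n v"
        using triv[of n v] by (cases "a n = 0") auto
    qed blast
  qed
  then show ?thesis
    unfolding ULC_def ulc_weight_def a_def[symmetric] dc using nonneg by blast
qed

section \<open>The operator 1 + s E preserves ultra-log-concavity\<close>

text \<open>
  With \<open>\<epsilon>\<^sub>0 = 0\<close> and \<open>\<epsilon>\<^sub>i = e\<^sub>i\<close>, let \<open>B = (a (n + \<epsilon>\<^sub>i + \<epsilon>\<^sub>j))\<close> and \<open>C = (a (n + e\<^sub>k + \<epsilon>\<^sub>i + \<epsilon>\<^sub>j))\<close>. Row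
  \<open>k\<close> of \<open>B\<close> is row \<open>0\<close> of \<open>C\<close>, and both forms are negative semidefinite on the kernel of this
  common row, hence so is \<open>B + s C\<close>. In the lemma, \<open>b, c, Bkk, B0, Bk, Bv\<close> are the values of \<open>B\<close> at
  \<open>(0,0), (0,k), (k,k), (0,v), (k,v), (v,v)\<close>, and \<open>c, Bk, Cv\<close> those of \<open>C\<close> at \<open>(0,0), (0,v), (v,v)\<close>;
  the vector \<open>x e\<^sub>0 + v\<close> lies in the kernel.
\<close>
lemma shared_row_form_le:
  fixes b c s B0 Bk Bv Bkk Cv :: real
  assumes "0 < b" "0 < c" "0 \<le> s" "0 \<le> Bkk"
    and B: "\<And>t. b * (Bv + 2 * t * Bk + t\<^sup>2 * Bkk) \<le> (B0 + t * c)\<^sup>2"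
    and C: "c * Cv \<le> Bk\<^sup>2"
  shows "(b + s * c) * (Bv + s * Cv) \<le> (B0 + s * Bk)\<^sup>2"
proof -
  define x where "x = - Bk / c"
  have Bk: "Bk = - x * c"
    using assms by (simp add: x_def)
  \<comment> \<open>the \<open>t\<close> for which \<open>x e\<^sub>0 + v + t e\<^sub>k\<close> is orthogonal to \<open>e\<^sub>0\<close> under \<open>B\<close>\<close>
  define t where "t = - (b * x + B0) / c"
  have tc: "t * c = - (b * x + B0)"
    using assms by (simp add: t_def)
  \<comment> \<open>The common row vanishes on x e_0 + v, so adding t e_k changes the form only by
    \<open>t\<^sup>2 * Bkk\<close>, which is nonnegative. For the chosen \<open>t\<close> the sum is
    orthogonal to e_0, where \<open>B\<close> makes the form nonpositive.\<close>
  have QB: "b * x\<^sup>2 + 2 * x * B0 + Bv \<le> 0"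
  proof -
    have "b * (Bv + 2 * t * Bk) \<le> b * (Bv + 2 * t * Bk + t\<^sup>2 * Bkk)"
      using assms by (intro mult_left_mono) auto
    also have "\<dots> \<le> (b * x)\<^sup>2"
      using B[of t] by (simp add: tc)
    finally have "b * (Bv + 2 * t * Bk) \<le> (b * x)\<^sup>2" .
    moreover have "t * Bk = (b * x + B0) * x"
      using tc unfolding Bk by (simp add: algebra_simps) algebra
    moreover have "b * (Bv + 2 * t * Bk) = b * Bv + 2 * b * (t * Bk)"
      by (simp add: algebra_simps)
    ultimately have "b * Bv + 2 * b * ((b * x + B0) * x) \<le> (b * x)\<^sup>2"
      by simp
    then have "b * (b * x\<^sup>2 + 2 * x * B0 + Bv) \<le> 0"
      by (simp add: algebra_simps power2_eq_square)
    then show ?thesis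
      using \<open>0 < b\<close> by (simp add: mult_le_0_iff)
  qed
  have QC: "c * x\<^sup>2 + 2 * x * Bk + Cv \<le> 0"
  proof -
    have "c * (Cv - c * x\<^sup>2) \<le> 0"
      using C by (simp add: Bk algebra_simps power2_eq_square)
    then have "Cv - c * x\<^sup>2 \<le> 0"
      using \<open>0 < c\<close> by (simp add: mult_le_0_iff)
    then show ?thesis
      by (simp add: Bk algebra_simps power2_eq_square)
  qed
  let ?d = "b + s * c" and ?D = "B0 + s * Bk" and ?E = "Bv + s * Cv"
  \<comment> \<open>A quadratic polynomial with positive leading coefficient that is nonpositive at
    some point has nonnegative discriminant, which is the claim.\<close>
  have "?d * x\<^sup>2 + 2 * x * ?D + ?E \<le> 0"
    using QB mult_left_mono[OF QC \<open>0 \<le> s\<close>] by (simp add: algebra_simps)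
  moreover have "0 < ?d"
    using assms by (simp add: add_pos_nonneg)
  ultimately have "?d * (?d * x\<^sup>2 + 2 * x * ?D + ?E) \<le> 0"
    by (simp add: mult_le_0_iff)
  moreover have "?d * (?d * x\<^sup>2 + 2 * x * ?D + ?E) = (?d * x + ?D)\<^sup>2 - ?D\<^sup>2 + ?d * ?E"
    by (simp add: algebra_simps power2_eq_square)
  ultimately show ?thesis
    using zero_le_power2[of "?d * x + ?D"] by linarith
qed

definition add_shift :: "'d \<Rightarrow> real \<Rightarrow> (('d \<Rightarrow> nat) \<Rightarrow> real) \<Rightarrow> ('d \<Rightarrow> nat) \<Rightarrow> real" where
  "add_shift k s a n = a n + s * a (n + unit_fun k)"

lemma ulc_weight_add_shift:
  assumes a: "ulc_weight a" and s: "0 \<le> s"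
  shows "ulc_weight (add_shift k s a)"
proof -
  note nonneg = ulc_weight_nonneg[OF a] and down = ulc_weight_zero_mono[OF a]
  show ?thesis
  proof (rule ulc_weightI)
    fix n :: "'a \<Rightarrow> nat"
    show "0 \<le> add_shift k s a n"
      using nonneg s by (simp add: add_shift_def)
  next
    fix m n :: "'a \<Rightarrow> nat"
    assume mn: "m \<le> n" and "add_shift k s a m = 0"
    then have "a m = 0"
      using nonneg[of m] mult_nonneg_nonneg[OF s nonneg, of "m + unit_fun k"]
      by (simp add: add_shift_def)
    then have "a n = 0" "a (n + unit_fun k) = 0"
      using down[OF mn] down[OF order.trans[OF mn le_add_fun]] by auto
    then show "add_shift k s a n = 0"
      by (simp add: add_shift_def)
  next
    fix n :: "'a \<Rightarrow> nat" and v :: "'a \<Rightarrow> real"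
    define row where "row m v = (\<Sum>i\<in>UNIV. a (m + unit_fun i) * v i)" for m v
    define form where "form m v = (\<Sum>i\<in>UNIV. \<Sum>j\<in>UNIV. v i * a (m + unit_fun i + unit_fun j) * v j)"
      for m v
    have le: "a m * form m v \<le> (row m v)\<^sup>2" for m v
      unfolding form_def row_def by (rule ulc_weight_form_le[OF a])
    let ?k = "n + unit_fun k"
    have shift_row: "(\<Sum>i\<in>UNIV. add_shift k s a (n + unit_fun i) * v i) = row n v + s * row ?k v"
      by (simp add: add_shift_def row_def algebra_simps sum.distrib sum_distrib_left)
    have shift_form: "(\<Sum>i\<in>UNIV. \<Sum>j\<in>UNIV. v i * add_shift k s a (n + unit_fun i + unit_fun j) * v j)
        = form n v + s * form ?k v"
      by (simp add: add_shift_def form_def algebra_simps sum.distrib sum_distrib_left)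
    have "add_shift k s a n * (form n v + s * form ?k v) \<le> (row n v + s * row ?k v)\<^sup>2"
    proof (cases "a ?k = 0")
      \<comment> \<open>The support does not reach \<open>?k\<close>, so every shifted term vanishes
        and the claim is the inequality for \<open>a\<close> at \<open>n\<close>.\<close>
      case True
      then have "a (?k + m) = 0" for m
        using down[OF le_add_fun] by blast
      then have "form ?k v = 0" "row ?k v = 0"
        by (simp_all add: form_def row_def add.assoc)
      then show ?thesis
        using True le by (simp add: add_shift_def)
    next
      case False
      then have "a n \<noteq> 0"
        using down[OF le_add_fun] by blast
      \<comment> \<open>The free parameter \<open>t\<close> of \<open>shared_row_form_le\<close>
        comes from testing the inequality at \<open>n\<close> on v + t e_k; the mixed term is the
        row at \<open>?k\<close>.\<close>
      have expand_row: "row n (\<lambda>i. v i + t * of_bool (i = k)) = row n v + t * a ?k" for t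
      proof -
        have "row n (\<lambda>i. v i + t * of_bool (i = k)) =
            row n v + (\<Sum>i\<in>UNIV. if i = k then t * a (n + unit_fun i) else 0)"
          unfolding row_def sum.distrib[symmetric] by (intro sum.cong refl) (simp add: algebra_simps)
        then show ?thesis by simp
      qed
      have expand_form: "form n (\<lambda>i. v i + t * of_bool (i = k)) =
          form n v + 2 * t * row ?k v + t\<^sup>2 * a (?k + unit_fun k)" for t
      proof -
        have pick: "(\<Sum>i\<in>UNIV. of_bool (i = k) * f i) = f k" for f :: "'a \<Rightarrow> real"
          by (simp add: of_bool_def if_distrib[of "\<lambda>x. x * _"] cong: if_cong)
        let ?c = "\<lambda>i j. a (n + unit_fun i + unit_fun j)"
        have "form n (\<lambda>i. v i + t * of_bool (i = k)) = form n v
            + t * (\<Sum>i\<in>UNIV. \<Sum>j\<in>UNIV. of_bool (j = k) * (v i * ?c i j))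
            + t * (\<Sum>i\<in>UNIV. \<Sum>j\<in>UNIV. of_bool (i = k) * (?c i j * v j))
            + t\<^sup>2 * (\<Sum>i\<in>UNIV. \<Sum>j\<in>UNIV. of_bool (i = k) * (of_bool (j = k) * ?c i j))"
          unfolding form_def sum_distrib_left sum.distrib[symmetric]
          by (intro sum.cong refl) (simp add: algebra_simps power2_eq_square)
        also have "\<dots> = form n v + 2 * t * row ?k v + t\<^sup>2 * a (?k + unit_fun k)"
          unfolding sum_distrib_left[symmetric] pick
          by (simp add: row_def add_ac mult.commute)
        finally show ?thesis .
      qed
      show ?thesis
        unfolding add_shift_def
      proof (rule shared_row_form_le[where Bkk = "a (?k + unit_fun k)"])
        show "0 < a n" "0 < a ?k" "0 \<le> a (?k + unit_fun k)"
          using False \<open>a n \<noteq> 0\<close> nonneg by (auto simp: less_le)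
        show "a n * (form n v + 2 * t * row ?k v + t\<^sup>2 * a (?k + unit_fun k))
            \<le> (row n v + t * a ?k)\<^sup>2" for t
          using le[of n "\<lambda>i. v i + t * of_bool (i = k)"] by (simp only: expand_row expand_form)
      qed (use s le in auto)
    qed
    then show "add_shift k s a n *
        (\<Sum>i\<in>UNIV. \<Sum>j\<in>UNIV. v i * add_shift k s a (n + unit_fun i + unit_fun j) * v j)
        \<le> (\<Sum>i\<in>UNIV. add_shift k s a (n + unit_fun i) * v i)\<^sup>2"
      by (simp only: shift_row shift_form)
  qed
qed

section \<open>Powers of 1 + s E, their limit exp (q E), and rescaling\<close>

lemma ulc_weight_funpow_add_shift:
  "ulc_weight a \<Longrightarrow> 0 \<le> s \<Longrightarrow> ulc_weight ((add_shift k s ^^ N) a)"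
  by (induction N) (auto intro: ulc_weight_add_shift)

lemma add_unit_fun: "n + unit_fun k = n(k := Suc (n k))"
  by (auto simp: unit_fun_def fun_eq_iff)

lemma funpow_add_shift:
  "(add_shift k s ^^ N) a n = (\<Sum>j\<le>N. real (N choose j) * s ^ j * a (n(k := n k + j)))"
proof (induction N arbitrary: n)
  case 0
  then show ?case by simp
next
  case (Suc N)
  define g where "g j = a (n(k := n k + j))" for j
  have "(add_shift k s ^^ Suc N) a n =
      (add_shift k s ^^ N) a n + s * (add_shift k s ^^ N) a (n(k := Suc (n k)))"
    by (simp add: add_shift_def add_unit_fun)
  also have "\<dots> = (\<Sum>j\<le>N. real (N choose j) * s ^ j * g j) +
      s * (\<Sum>j\<le>N. real (N choose j) * s ^ j * g (Suc j))"
    unfolding Suc.IH g_def by simp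
  \<comment> \<open>The extra term is zero as \<open>N choose Suc N = 0\<close>; splitting off
    \<open>j = 0\<close> then aligns this sum with the shifted one for Pascal's rule.\<close>
  also have "(\<Sum>j\<le>N. real (N choose j) * s ^ j * g j) =
      (\<Sum>j\<le>Suc N. real (N choose j) * s ^ j * g j)"
    by simp
  also have "\<dots> = g 0 + (\<Sum>j\<le>N. real (N choose Suc j) * s ^ Suc j * g (Suc j))"
    by (subst sum.atMost_Suc_shift) simp
  also have "\<dots> + s * (\<Sum>j\<le>N. real (N choose j) * s ^ j * g (Suc j)) =
      g 0 + (\<Sum>j\<le>N. real (Suc N choose Suc j) * s ^ Suc j * g (Suc j))"
    by (simp add: sum_distrib_left sum.distrib[symmetric] algebra_simps)
  also have "\<dots> = (\<Sum>j\<le>Suc N. real (Suc N choose j) * s ^ j * g j)"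
    by (subst sum.atMost_Suc_shift[of _ N]) simp
  finally show ?case by (simp only: g_def)
qed

text \<open>The inequalities are closed conditions, but positive values may tend to 0, so the
  condition on zeros is asked of the limit itself.\<close>

lemma ulc_weight_lim:
  assumes F: "\<And>N. ulc_weight (F N)"
    and lim: "\<And>n. (\<lambda>N. F N n) \<longlonglongrightarrow> a n"
    and down: "\<And>m n. m \<le> n \<Longrightarrow> a m = 0 \<Longrightarrow> a n = 0"
  shows "ulc_weight a"
proof (rule ulc_weightI)
  show "0 \<le> a n" for n
    using lim by (rule LIMSEQ_le_const) (auto intro: ulc_weight_nonneg[OF F])
  show "a n * (\<Sum>i\<in>UNIV. \<Sum>j\<in>UNIV. v i * a (n + unit_fun i + unit_fun j) * v j)
      \<le> (\<Sum>i\<in>UNIV. a (n + unit_fun i) * v i)\<^sup>2" for n v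
  proof (rule LIMSEQ_le)
    show "(\<lambda>N. F N n * (\<Sum>i\<in>UNIV. \<Sum>j\<in>UNIV. v i * F N (n + unit_fun i + unit_fun j) * v j))
        \<longlonglongrightarrow> a n * (\<Sum>i\<in>UNIV. \<Sum>j\<in>UNIV. v i * a (n + unit_fun i + unit_fun j) * v j)"
      by (intro tendsto_intros lim)
    show "(\<lambda>N. (\<Sum>i\<in>UNIV. F N (n + unit_fun i) * v i)\<^sup>2)
        \<longlonglongrightarrow> (\<Sum>i\<in>UNIV. a (n + unit_fun i) * v i)\<^sup>2"
      by (intro tendsto_intros lim)
  qed (auto intro: ulc_weight_form_le[OF F])
qed (fact down)

lemma binomial_over_power_limit: "(\<lambda>N. real (N choose j) / real N ^ j) \<longlonglongrightarrow> 1 / fact j"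
proof (induction j)
  case 0
  then show ?case by simp
next
  case (Suc j)
  have "(\<lambda>N. 1 - real j / real N) \<longlonglongrightarrow> 1 - 0"
    by (intro tendsto_diff tendsto_const lim_const_over_n)
  then have "(\<lambda>N. real (N choose j) / real N ^ j * (1 - real j / real N) / real (Suc j))
      \<longlonglongrightarrow> 1 / fact j * (1 - 0) / real (Suc j)"
    by (intro tendsto_intros Suc) auto
  moreover have "\<forall>\<^sub>F N in sequentially.
      real (N choose j) / real N ^ j * (1 - real j / real N) / real (Suc j)
      = real (N choose Suc j) / real N ^ Suc j"
    \<comment> \<open>For \<open>N > j\<close> the truncated difference \<open>N - j\<close> is
      exact and \<open>N\<close> is nonzero.\<close>
    using eventually_gt_at_top[of j]
  proof eventually_elim
    case (elim N)
    have "Suc j * (N choose Suc j) = (N - j) * (N choose j)"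
      by (simp only: binomial_absorption binomial_absorb_comp)
    then have "real (Suc j) * real (N choose Suc j) = (real N - real j) * real (N choose j)"
      using elim by (metis of_nat_mult of_nat_diff less_imp_le)
    then have "real (N choose Suc j) = (real N - real j) * real (N choose j) / real (Suc j)"
      by (simp add: nonzero_eq_divide_eq mult.commute)
    moreover have "1 - real j / real N = (real N - real j) / real N"
      using elim by (simp add: diff_divide_distrib)
    ultimately show ?case
      by (simp add: mult_ac)
  qed
  ultimately show ?case
    by (auto intro: Lim_transform_eventually simp: field_simps)
qed

text \<open>The coefficients of (1 + (q / N) E)^N converge termwise to those of exp (q E) and are
  dominated by them, since \<open>N choose j\<close> is at most \<open>N ^ j / fact j\<close>.
  Tannery's theorem then gives convergence of the sums.\<close>

lemma ulc_weight_exp_shift: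
  assumes a: "ulc_weight a" and q: "0 \<le> q"
    and summable: "\<And>n. summable (\<lambda>j. q ^ j / fact j * a (n(k := n k + j)))"
  shows "ulc_weight (\<lambda>n. \<Sum>j. q ^ j / fact j * a (n(k := n k + j)))" (is "ulc_weight ?T")
proof (rule ulc_weight_lim)
  note nonneg = ulc_weight_nonneg[OF a] and down = ulc_weight_zero_mono[OF a]
  show "ulc_weight ((add_shift k (q / real N) ^^ N) a)" for N
    using a q by (intro ulc_weight_funpow_add_shift) auto
  show "(\<lambda>N. (add_shift k (q / real N) ^^ N) a n) \<longlonglongrightarrow> ?T n" for n
  proof -
    define g where "g j = a (n(k := n k + j))" for j
    define h where "h j N = real (N choose j) / real N ^ j * (q ^ j * g j)" for j N
    have "(add_shift k (q / real N) ^^ N) a n = (\<Sum>j. h j N)" for N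
    proof -
      have "(add_shift k (q / real N) ^^ N) a n = (\<Sum>j\<le>N. h j N)"
        by (simp add: funpow_add_shift h_def g_def power_divide mult_ac)
      also have "\<dots> = (\<Sum>j. h j N)"
        by (rule suminf_finite[symmetric]) (auto simp: h_def)
      finally show ?thesis .
    qed
    moreover have "(\<lambda>N. \<Sum>j. h j N) \<longlonglongrightarrow> (\<Sum>j. 1 / fact j * (q ^ j * g j))"
    proof (rule tannerys_theorem[THEN conjunct2, THEN conjunct2])
      show "(\<lambda>N. h j N) \<longlonglongrightarrow> 1 / fact j * (q ^ j * g j)" for j
        unfolding h_def by (intro tendsto_mult_right binomial_over_power_limit)
      have "norm (h j N) \<le> q ^ j / fact j * g j" for j N
      proof -
        have "real (N choose j) * fact j \<le> real N ^ j"
          using of_nat_mono[OF binomial_fact_pow[of N j], where 'a = real] by simp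
        then have "real (N choose j) / real N ^ j \<le> 1 / fact j"
          by (cases "N = 0") (auto simp: field_simps power_0_left)
        then have "h j N \<le> 1 / fact j * (q ^ j * g j)"
          unfolding h_def using q nonneg by (intro mult_right_mono) (auto simp: g_def)
        moreover have "0 \<le> h j N"
          unfolding h_def g_def using q nonneg by auto
        ultimately show ?thesis by simp
      qed
      then show "\<forall>\<^sub>F (j, N) in at_top \<times>\<^sub>F sequentially. norm (h j N) \<le> q ^ j / fact j * g j"
        by (intro always_eventually) auto
      show "summable (\<lambda>j. q ^ j / fact j * g j)"
        unfolding g_def by (rule summable)
    qed simp
    ultimately show ?thesis
      by (simp add: g_def)
  qed
  show "?T n = 0" if "m \<le> n" "?T m = 0" for m n
  proof -
    \<comment> \<open>The term \<open>j = 0\<close> of this nonnegative series is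
      \<open>a m\<close>, so \<open>a m\<close> vanishes, and every point occurring in
      \<open>?T n\<close> lies above \<open>m\<close>.\<close>
    have "q ^ 0 / fact 0 * a (m(k := m k + 0)) \<le> ?T m"
      using sum_le_suminf[OF summable[of m], of "{0}"] nonneg q by simp
    then have "a m = 0"
      using nonneg[of m] that by simp
    moreover have "m \<le> n(k := n k + j)" for j
      using \<open>m \<le> n\<close> by (auto simp: le_fun_def intro: trans_le_add1)
    ultimately have "a (n(k := n k + j)) = 0" for j
      using down by blast
    then show ?thesis by simp
  qed
qed

lemma ulc_weight_scale:
  assumes a: "ulc_weight a" and c: "0 < c"
  shows "ulc_weight (\<lambda>n. c ^ n k * a n)"
proof (rule ulc_weightI)
  note nonneg = ulc_weight_nonneg[OF a] and down = ulc_weight_zero_mono[OF a]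
  show "0 \<le> c ^ n k * a n" for n
    using nonneg c by simp
  show "c ^ n k * a n = 0" if "m \<le> n" "c ^ m k * a m = 0" for m n
    using that down[OF that(1)] c by simp
  fix n :: "'a \<Rightarrow> nat" and v :: "'a \<Rightarrow> real"
  \<comment> \<open>The factor is multiplicative in \<open>n\<close>, so the increments from
    \<open>unit_fun i\<close> and \<open>unit_fun j\<close> are absorbed into the test
    vector.\<close>
  define w where "w i = c ^ unit_fun i k * v i" for i
  have "c ^ n k * a n *
      (\<Sum>i\<in>UNIV. \<Sum>j\<in>UNIV. v i * (c ^ (n + unit_fun i + unit_fun j) k * a (n + unit_fun i + unit_fun j)) * v j)
      = (c ^ n k)\<^sup>2 * (a n * (\<Sum>i\<in>UNIV. \<Sum>j\<in>UNIV. w i * a (n + unit_fun i + unit_fun j) * w j))"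
    by (simp add: w_def power_add sum_distrib_left power2_eq_square mult_ac)
  also have "\<dots> \<le> (c ^ n k)\<^sup>2 * (\<Sum>i\<in>UNIV. a (n + unit_fun i) * w i)\<^sup>2"
    by (intro mult_left_mono ulc_weight_form_le[OF a]) auto
  also have "\<dots> = (\<Sum>i\<in>UNIV. c ^ (n + unit_fun i) k * a (n + unit_fun i) * v i)\<^sup>2"
    by (simp add: w_def power_add sum_distrib_left power_mult_distrib[symmetric] mult_ac)
  finally show "c ^ n k * a n *
      (\<Sum>i\<in>UNIV. \<Sum>j\<in>UNIV. v i * (c ^ (n + unit_fun i + unit_fun j) k * a (n + unit_fun i + unit_fun j)) * v j)
      \<le> (\<Sum>i\<in>UNIV. c ^ (n + unit_fun i) k * a (n + unit_fun i) * v i)\<^sup>2" .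
qed

section \<open>Binomial thinning, one coordinate at a time\<close>

lemma binomial_pmf_1: "binomial_pmf n 1 = return_pmf n"
  by (rule set_pmf_subset_singleton[THEN iffD1]) simp

lemma thinning_1: "thinning (\<lambda>_. 1) \<mu> = \<mu>"
  by (simp add: thinning_def binomial_pmf_1 bind_return_pmf')

text \<open>In each coordinate one of the two binomial laws is a point mass, so they compose
  trivially; \<open>Pi_pmf_bind\<close> assembles the coordinates.\<close>

lemma thinning_thinning_disjoint:
  assumes "\<And>i. p i = 1 \<or> q i = 1"
  shows "thinning q (thinning p \<mu>) = thinning (\<lambda>i. p i * q i) \<mu>"
proof -
  have "bind_pmf (binomial_pmf m (p i)) (\<lambda>l. binomial_pmf l (q i)) = binomial_pmf m (p i * q i)"
    for m i
    using assms[of i] by (auto simp: binomial_pmf_1 bind_return_pmf bind_return_pmf')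
  then have "Pi_pmf UNIV 0 (\<lambda>i. binomial_pmf (n i) (p i * q i)) =
      bind_pmf (Pi_pmf UNIV 0 (\<lambda>i. binomial_pmf (n i) (p i)))
        (\<lambda>m. Pi_pmf UNIV 0 (\<lambda>i. binomial_pmf (m i) (q i)))" for n :: "'a \<Rightarrow> nat"
    using Pi_pmf_bind[OF finite, of UNIV 0 "\<lambda>i. binomial_pmf (n i) (p i)"
        "\<lambda>i l. binomial_pmf l (q i)" 0] by simp
  then show ?thesis
    by (simp add: thinning_def bind_assoc_pmf)
qed

text \<open>This is exp (q E) with \<open>q = 1 - p\<close>: multiplying by n! turns the coefficient
  \<open>(n k + j) choose n k\<close> into (n + j e_k)! / j!. The form with \<open>sums\<close> also
  supplies the summability that \<open>ulc_weight_exp_shift\<close> asks for.\<close>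

lemma fact_weight_thinning_single:
  fixes k :: "'d::finite"
  assumes p: "0 < p" "p \<le> 1"
  defines "P \<equiv> (\<lambda>i. if i = k then p else 1)"
  shows "(\<lambda>j. p ^ n k * ((1 - p) ^ j / fact j * fact_weight \<mu> (n(k := n k + j))))
           sums fact_weight (thinning P \<mu>) n"
proof -
  define \<sigma> where "\<sigma> j = n(k := n k + j)" for j
  have \<sigma>: "inj \<sigma>"
    by (rule injI) (auto simp: \<sigma>_def dest!: fun_cong[of _ _ k])
  define g where "g m = pmf (Pi_pmf UNIV 0 (\<lambda>i. binomial_pmf (m i) (P i))) n" for m
  define f where "f m = pmf \<mu> m * g m" for m
  have g: "g m = (\<Prod>i\<in>UNIV - {k}. of_bool (m i = n i)) * pmf (binomial_pmf (m k) p) (n k)" for m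
    unfolding g_def by (subst pmf_Pi', simp, simp, subst prod.remove[of _ k])
      (auto simp: P_def binomial_pmf_1 indicator_def mult.commute intro!: prod.cong)
  \<comment> \<open>For \<open>p = 1\<close> only \<open>j = 0\<close> survives, by
    \<open>0 ^ 0 = 1\<close>.\<close>
  have g_\<sigma>: "g (\<sigma> j) = real ((n k + j) choose n k) * p ^ n k * (1 - p) ^ j" for j
    unfolding g using p by (simp add: \<sigma>_def)
  \<comment> \<open>Thinning coordinate \<open>k\<close> fixes the other coordinates and cannot
    raise this one, so only the points n + j e_k can lead to \<open>n\<close>.\<close>
  have f0: "f m = 0" if "m \<notin> range \<sigma>" for m
  proof (rule ccontr)
    assume "f m \<noteq> 0"
    then have "\<forall>i\<in>UNIV - {k}. m i = n i" "n k \<le> m k"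
      using p by (auto simp: f_def g not_le)
    then have "m = \<sigma> (m k - n k)"
      by (auto simp: \<sigma>_def fun_eq_iff)
    then show False
      using that by blast
  qed
  have "Infinite_Set_Sum.abs_summable_on f UNIV"
    by (rule abs_summable_on_comparison_test[OF pmf_abs_summable[of \<mu>]])
      (auto simp: f_def g_def pmf_le_1 mult_left_le)
  then have "Infinite_Set_Sum.abs_summable_on f (range \<sigma>)"
    by (rule abs_summable_on_subset) simp
  then have summ: "Infinite_Set_Sum.abs_summable_on (\<lambda>j. f (\<sigma> j)) UNIV"
    using abs_summable_on_reindex_iff[OF \<sigma>] by blast
  have "pmf (thinning P \<mu>) n = infsetsum f UNIV"
    unfolding thinning_def pmf_bind pmf_expectation_eq_infsetsum f_def g_def ..
  also have "\<dots> = infsetsum f (range \<sigma>)"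
    using f0 by (intro infsetsum_cong_neutral) auto
  also have "\<dots> = infsetsum (\<lambda>j. f (\<sigma> j)) UNIV"
    by (rule infsetsum_reindex[OF \<sigma>])
  finally have "(\<lambda>j. f (\<sigma> j)) sums pmf (thinning P \<mu>) n"
    using sums_infsetsum_nat[OF summ] by simp
  then have "(\<lambda>j. (\<Prod>i\<in>UNIV. fact (n i)) * f (\<sigma> j)) sums fact_weight (thinning P \<mu>) n"
    unfolding fact_weight_def by (rule sums_mult)
  moreover have "(\<Prod>i\<in>UNIV. fact (n i)) * f (\<sigma> j) =
      p ^ n k * ((1 - p) ^ j / fact j * fact_weight \<mu> (\<sigma> j))" for j
  proof -
    define R :: real where "R = (\<Prod>i\<in>UNIV - {k}. fact (n i))"
    have 1: "(\<Prod>i\<in>UNIV. fact (n i)) = fact (n k) * R"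
      unfolding R_def by (rule prod.remove) auto
    have 2: "(\<Prod>i\<in>UNIV. fact (\<sigma> j i)) = fact (n k + j) * R"
      unfolding R_def by (subst prod.remove[of _ k]) (auto simp: \<sigma>_def intro!: prod.cong)
    have 3: "real ((n k + j) choose n k) = fact (n k + j) / (fact (n k) * fact j)"
      by (subst binomial_fact) auto
    show ?thesis
      by (simp add: fact_weight_def f_def g_\<sigma> 1 2 3)
  qed
  ultimately show ?thesis
    by (simp add: \<sigma>_def)
qed

lemma ULC_thinning_single:
  assumes \<mu>: "ULC \<mu>" and p: "0 < p" "p \<le> 1"
  shows "ULC (thinning (\<lambda>i. if i = k then p else 1) \<mu>)"
proof -
  let ?a = "fact_weight \<mu>"
  let ?T = "\<lambda>n. \<Sum>j. (1 - p) ^ j / fact j * ?a (n(k := n k + j))"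
  note sums = fact_weight_thinning_single[OF p, of n k \<mu> for n]
  have summable: "summable (\<lambda>j. (1 - p) ^ j / fact j * ?a (n(k := n k + j)))" for n
    using sums_summable[OF sums[of n]] p by (simp add: summable_mult_D)
  have "ulc_weight (\<lambda>n. p ^ n k * ?T n)"
    using \<mu> p by (intro ulc_weight_scale ulc_weight_exp_shift summable) (auto simp: ULC_iff_ulc_weight)
  moreover have "p ^ n k * ?T n = fact_weight (thinning (\<lambda>i. if i = k then p else 1) \<mu>) n" for n
    using sums_unique[OF sums[of n]] suminf_mult[OF summable] by simp
  ultimately show ?thesis
    by (simp add: ULC_iff_ulc_weight)
qed

theorem propositionE6:
  fixes \<mu> :: "('d::finite \<Rightarrow> nat) pmf" and p :: "'d \<Rightarrow> real"
  assumes "ULC \<mu>"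
    and "\<And>i. p i \<in> {0<..1}"
  shows "ULC (thinning p \<mu>)"
proof -
  have "ULC (thinning (\<lambda>i. if i \<in> A then p i else 1) \<mu>)" if "finite A" for A
    using that
  proof induction
    case empty
    then show ?case
      using assms by (simp add: thinning_1)
  next
    case (insert k A)
    \<comment> \<open>As \<open>k\<close> is not in \<open>A\<close>, each coordinate is thinned by
      at most one of the two factors.\<close>
    have "thinning (\<lambda>i. if i \<in> insert k A then p i else 1) \<mu> =
        thinning (\<lambda>i. if i = k then p k else 1) (thinning (\<lambda>i. if i \<in> A then p i else 1) \<mu>)"
      using insert.hyps by (subst thinning_thinning_disjoint) (auto intro!: arg_cong2[of _ _ _ _ thinning])
    then show ?case
      using ULC_thinning_single[OF insert.IH, of "p k" k] assms(2)[of k] by simp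
  qed
  from this[of UNIV] show ?thesis
    by simp
qed

end
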